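(* Let $n\ge2$. For every $M\in\mathcal{M}_P$ and every $A\in\mathcal{A}$, $$\mathrm{Vol}_1(\gamma_{M^{-1}})=\mathrm{Vol}_1\bigl(\gamma_{(AMA^\top)^{-1}}\bigr).$$
   Context: Let $f_P(x)=(1,x,\ldots,x^{n-1})^\top$ and $g_P(x)=\frac{d}{dx}f_P(x)$ for $x\in\mathbb{R}$. For a positive definite $n\times n$ matrix $\Sigma$, define the tube-volume criterion $$\mathrm{Vol}_1(\gamma_\Sigma)=2\int_{-\infty}^{\infty}\frac{\sqrt{(f_P(x)^\top\Sigma f_P(x))(g_P(x)^\top\Sigma g_P(x))-(f_P(x)^\top\Sigma g_P(x))^2}}{f_P(x)^\top\Sigma f_P(x)}\,dx ,$$ which is the length of the curve $\gamma_\Sigma=\{\pm\Sigma^{1/2}f_P(x)/\|\Sigma^{1/2}f_P(x)\| \mid x\in\mathbb{R}\}$ on the unit sphere. The moment cone $\mathcal{M}_P$ is the set of all positive definite $n\times n$ matrices of the form $\int_{\mathbb{R}} f_P(x)f_P(x)^\top\,d\rho(x)$, where $\rho$ is a nonnegative finite measure on $\mathbb{R}$ for which the integral exists. For real $a,b,c,d$ with $ad-bc\neq0$, $A(a,b,c,d)$ is the $n\times n$ matrix determined by $(cx+d)^{n-1}f_P\!\left(\frac{ax+b}{cx+d}\right)=A(a,b,c,d)f_P(x)$; i.e. the $i$-th entry of $A(a,b,c,d)f_P(x)$ is the polynomial $(ax+b)^{i-1}(cx+d)^{n-i}$. Put $\mathcal{A}=\{A(a,b,c,d)\mid ad-bc\ne0\}$.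 *)

theory Defs
  imports
    "HOL-Analysis.Analysis"
    "Jordan_Normal_Form.Gauss_Jordan_Elimination"
begin

unbundle no vec_syntax and no inner_syntax
hide_type (open) Finite_Cartesian_Product.vec
hide_const (open) Finite_Cartesian_Product.vec Finite_Cartesian_Product.mat
  Finite_Cartesian_Product.row Finite_Cartesian_Product.column
  Finite_Cartesian_Product.transpose Determinants.det

text \<open>
  The dimension \<open>n\<close> is a natural number; vectors and matrices are those of
  \<open>Jordan_Normal_Form.Matrix\<close>, whose indices run over \<open>0, \<dots>, n - 1\<close>.
\<close>

definition f_P :: "nat \<Rightarrow> real \<Rightarrow> real vec" where
  "f_P n x = vec n (\<lambda>i. x ^ i)"

definition g_P :: "nat \<Rightarrow> real \<Rightarrow> real vec" where
  "g_P n x = vec n (\<lambda>i. deriv (\<lambda>y. f_P n y $ i) x)"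

definition positive_definite :: "nat \<Rightarrow> real mat \<Rightarrow> bool" where
  "positive_definite n S \<longleftrightarrow>
     S \<in> carrier_mat n n \<and> transpose_mat S = S \<and>
     (\<forall>v \<in> carrier_vec n. v \<noteq> 0\<^sub>v n \<longrightarrow> v \<bullet> (S *\<^sub>v v) > 0)"

text \<open>
  The tube-volume criterion as a Lebesgue integral. For positive definite \<open>S\<close> the
  integrand is nonnegative and integrable (the denominator is positive everywhere), so the
  value \<open>0\<close> that the library assigns to divergent integrals plays no role there.
\<close>

definition Vol\<^sub>1 :: "nat \<Rightarrow> real mat \<Rightarrow> real" where
  "Vol\<^sub>1 n S = 2 * (\<integral>x. sqrt ((f_P n x \<bullet> (S *\<^sub>v f_P n x)) * (g_P n x \<bullet> (S *\<^sub>v g_P n x))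
                          - (f_P n x \<bullet> (S *\<^sub>v g_P n x))\<^sup>2)
                     / (f_P n x \<bullet> (S *\<^sub>v f_P n x)) \<partial>lborel)"

definition moment_cone :: "nat \<Rightarrow> real mat set" where
  "moment_cone n =
     {M. positive_definite n M \<and>
         (\<exists>\<rho> :: real measure.
            finite_measure \<rho> \<and> sets \<rho> = sets borel \<and>
            (\<forall>i<n. \<forall>j<n. integrable \<rho> (\<lambda>x. f_P n x $ i * f_P n x $ j)) \<and>
            M = mat n n (\<lambda>(i, j). \<integral>x. f_P n x $ i * f_P n x $ j \<partial>\<rho>))}"

definition moebius_mat :: "nat \<Rightarrow> real \<Rightarrow> real \<Rightarrow> real \<Rightarrow> real \<Rightarrow> real mat" where
  "moebius_mat n a b c d =
     (THE A. A \<in> carrier_mat n n \<and>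
        (\<forall>x. c * x + d \<noteq> 0 \<longrightarrow>
           (c * x + d) ^ (n - 1) \<cdot>\<^sub>v f_P n ((a * x + b) / (c * x + d)) = A *\<^sub>v f_P n x))"

definition moebius_mats :: "nat \<Rightarrow> real mat set" where
  "moebius_mats n = {moebius_mat n a b c d | a b c d. a * d - b * c \<noteq> 0}"

text \<open>
  The defining relation does determine a unique matrix, namely the one with the entries
  described by the polynomials \<open>(a x + b) ^ i * (c x + d) ^ (n - 1 - i)\<close>.
\<close>

lemma f_P_carrier [simp]: "f_P n x \<in> carrier_vec n" and dim_f_P [simp]: "dim_vec (f_P n x) = n"
  by (simp_all add: f_P_def)

lemma mult_f_P:
  assumes "A \<in> carrier_mat n n" "i < n"
  shows "(A *\<^sub>v f_P n x) $ i = (\<Sum>j<n. A $$ (i, j) * x ^ j)"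
  using assms by (auto simp: scalar_prod_def f_P_def atLeast0LessThan intro!: sum.cong)

lemma moebius_mat_unique:
  assumes A: "A \<in> carrier_mat n n" and B: "B \<in> carrier_mat n n"
    and nz: "c \<noteq> 0 \<or> d \<noteq> (0::real)"
    and eq: "\<And>x. c * x + d \<noteq> 0 \<Longrightarrow> A *\<^sub>v f_P n x = B *\<^sub>v f_P n x"
  shows "A = B"
proof (rule eq_matI)
  fix i j assume "i < dim_row B" "j < dim_col B"
  then have ij: "i < n" "j < n" using B by auto
  let ?p = "\<Sum>k<n. monom (A $$ (i, k) - B $$ (i, k)) k"
  have "finite {x. c * x + d = 0}"
  proof (rule finite_subset)
    show "{x. c * x + d = 0} \<subseteq> {- d / c}"
      using nz by (cases "c = 0") (auto simp: field_simps eq_neg_iff_add_eq_0)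
  qed simp
  then have "infinite (- {x. c * x + d = 0})"
    by (simp add: Compl_eq_Diff_UNIV infinite_UNIV_char_0)
  moreover have "- {x. c * x + d = 0} \<subseteq> {x. poly ?p x = 0}"
  proof safe
    fix x assume "c * x + d \<noteq> 0"
    from arg_cong[OF eq[OF this], of "\<lambda>v. v $ i"]
    have "(\<Sum>k<n. A $$ (i, k) * x ^ k) = (\<Sum>k<n. B $$ (i, k) * x ^ k)"
      using mult_f_P[OF A ij(1), of x] mult_f_P[OF B ij(1), of x] by simp
    then show "poly ?p x = 0"
      by (simp add: poly_sum poly_monom left_diff_distrib sum_subtractf)
  qed
  ultimately have "infinite {x. poly ?p x = 0}"
    using finite_subset by blast
  then have "?p = 0"
    using poly_roots_finite by blast
  then have "coeff ?p j = 0" by simp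
  then show "A $$ (i, j) = B $$ (i, j)"
    using ij by (simp add: coeff_sum if_distrib cong: if_cong)
qed (use A B in auto)

lemma moebius_mat_characterization:
  assumes "a * d - b * c \<noteq> (0::real)"
  shows moebius_mat_carrier: "moebius_mat n a b c d \<in> carrier_mat n n"
    and moebius_mat_f_P:
      "moebius_mat n a b c d *\<^sub>v f_P n x =
         vec n (\<lambda>i. (a * x + b) ^ i * (c * x + d) ^ (n - 1 - i))"
    and moebius_mat_entries:
      "moebius_mat n a b c d =
         mat n n (\<lambda>(i, j). coeff ([:b, a:] ^ i * [:d, c:] ^ (n - 1 - i)) j)"
proof -
  let ?p = "\<lambda>i. [:b, a:] ^ i * [:d, c:] ^ (n - 1 - i)"
  let ?B = "mat n n (\<lambda>(i, j). coeff (?p i) j)"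
  have nz: "c \<noteq> 0 \<or> d \<noteq> 0" using assms by auto
  have B: "?B \<in> carrier_mat n n" by simp
  have Bf: "?B *\<^sub>v f_P n x = vec n (\<lambda>i. (a * x + b) ^ i * (c * x + d) ^ (n - 1 - i))" for x
  proof (rule eq_vecI)
    fix i assume "i < dim_vec (vec n (\<lambda>i. (a * x + b) ^ i * (c * x + d) ^ (n - 1 - i)))"
    then have i: "i < n" by simp
    have "degree (?p i) \<le> degree ([:b, a:] ^ i) + degree ([:d, c:] ^ (n - 1 - i))"
      by (rule degree_mult_le)
    also have "\<dots> \<le> degree [:b, a:] * i + degree [:d, c:] * (n - 1 - i)"
      by (intro add_mono degree_power_le)
    also have "\<dots> \<le> 1 * i + 1 * (n - 1 - i)"
      by (intro add_mono mult_right_mono) auto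
    finally have deg: "degree (?p i) \<le> n - 1" using i by simp
    have "(?B *\<^sub>v f_P n x) $ i = (\<Sum>j<n. coeff (?p i) j * x ^ j)"
      using mult_f_P[OF B i, of x] i by simp
    also have "{..<n} = {..n - 1}" using i by auto
    also have "(\<Sum>j\<le>n - 1. coeff (?p i) j * x ^ j) = poly (?p i) x"
      unfolding poly_altdef by (rule sum.mono_neutral_right) (use deg in \<open>auto simp: coeff_eq_0\<close>)
    also have "\<dots> = (a * x + b) ^ i * (c * x + d) ^ (n - 1 - i)"
      by (simp add: algebra_simps)
    finally show "(?B *\<^sub>v f_P n x) $ i =
        vec n (\<lambda>i. (a * x + b) ^ i * (c * x + d) ^ (n - 1 - i)) $ i"
      using i by simp
  qed simp
  have rel: "(c * x + d) ^ (n - 1) \<cdot>\<^sub>v f_P n ((a * x + b) / (c * x + d)) = ?B *\<^sub>v f_P n x"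
    if "c * x + d \<noteq> 0" for x
  proof -
    have "(c * x + d) ^ (n - 1) * ((a * x + b) / (c * x + d)) ^ i =
        (a * x + b) ^ i * (c * x + d) ^ (n - 1 - i)" if i: "i < n" for i
    proof -
      have "(c * x + d) ^ (n - 1) = (c * x + d) ^ i * (c * x + d) ^ (n - 1 - i)"
        using i by (simp flip: power_add)
      then show ?thesis using \<open>c * x + d \<noteq> 0\<close> by (simp add: power_divide)
    qed
    then show ?thesis unfolding Bf by (intro eq_vecI) (auto simp: f_P_def)
  qed
  have "moebius_mat n a b c d = ?B"
    unfolding moebius_mat_def
  proof (rule the_equality)
    show "?B \<in> carrier_mat n n \<and> (\<forall>x. c * x + d \<noteq> 0 \<longrightarrow>
        (c * x + d) ^ (n - 1) \<cdot>\<^sub>v f_P n ((a * x + b) / (c * x + d)) = ?B *\<^sub>v f_P n x)"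
      using B rel by blast
  next
    fix A assume "A \<in> carrier_mat n n \<and> (\<forall>x. c * x + d \<noteq> 0 \<longrightarrow>
        (c * x + d) ^ (n - 1) \<cdot>\<^sub>v f_P n ((a * x + b) / (c * x + d)) = A *\<^sub>v f_P n x)"
    then show "A = ?B" using rel by (intro moebius_mat_unique[OF _ B nz]) auto
  qed
  then show "moebius_mat n a b c d \<in> carrier_mat n n"
    and "moebius_mat n a b c d *\<^sub>v f_P n x =
         vec n (\<lambda>i. (a * x + b) ^ i * (c * x + d) ^ (n - 1 - i))"
    and "moebius_mat n a b c d = ?B"
    using B Bf by auto
qed

text \<open>
  The library's \<open>mat_inverse\<close> returns \<open>None\<close> on singular matrices; \<open>mat_inv\<close> is
  meaningful for invertible (in particular positive definite) arguments only.
\<close>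

definition mat_inv :: "real mat \<Rightarrow> real mat" where
  "mat_inv M = the (mat_inverse M)"

end

theory Submission
  imports Defs "Jordan_Normal_Form.Determinant"
begin

text \<open>
  Let \<open>S = M\<^sup>-\<^sup>1\<close> and \<open>S' = (A M A\<^sup>T)\<^sup>-\<^sup>1\<close>, so that \<open>A\<^sup>T S' A = S\<close>: the integrand for \<open>S\<close> is the
  integrand for \<open>S'\<close> with \<open>f\<close> replaced by \<open>A f\<close>. Since \<open>A f(x) = u(x) f(\<phi> x)\<close> for the Moebius
  map \<open>\<phi>\<close>, the rescaling by \<open>u\<close> cancels in the quotient of the square root of the Gram determinant
  by the squared norm, and the chain rule contributes the factor \<open>\<bar>\<phi>' x\<bar>\<close>. The claim is the
  substitution \<open>y = \<phi> x\<close> on the complement of the pole.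
\<close>

section \<open>The integrand and its measurability\<close>

definition tube_density :: "nat \<Rightarrow> real mat \<Rightarrow> real \<Rightarrow> real" where
  "tube_density n S x =
     sqrt ((f_P n x \<bullet> (S *\<^sub>v f_P n x)) * (g_P n x \<bullet> (S *\<^sub>v g_P n x))
           - (f_P n x \<bullet> (S *\<^sub>v g_P n x))\<^sup>2) / (f_P n x \<bullet> (S *\<^sub>v f_P n x))"

lemma Vol\<^sub>1_eq_tube_density: "Vol\<^sub>1 n S = 2 * integral\<^sup>L lborel (tube_density n S)"
  unfolding Vol\<^sub>1_def tube_density_def ..

lemma g_P_eq: "g_P n x = vec n (\<lambda>i. real i * x ^ (i - 1))"
proof -
  have "deriv (\<lambda>y. f_P n y $ i) x = real i * x ^ (i - 1)" if "i < n" for i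
  proof -
    have "((\<lambda>y. y ^ i) has_field_derivative real i * x ^ (i - 1)) (at x)"
      using DERIV_pow[of i x] by simp
    then show ?thesis
      using that by (simp add: f_P_def DERIV_imp_deriv)
  qed
  then show ?thesis
    unfolding g_P_def by (intro eq_vecI) simp_all
qed

lemma g_P_carrier [simp]: "g_P n x \<in> carrier_vec n"
  by (simp add: g_P_def)

lemma tube_density_measurable [measurable]:
  assumes "S \<in> carrier_mat n n"
  shows "tube_density n S \<in> borel_measurable borel"
proof -
  have dim: "dim_row S = n" "dim_col S = n" using assms by auto
  show ?thesis
    unfolding tube_density_def g_P_eq f_P_def scalar_prod_def mult_mat_vec_def
    by (simp add: dim)
qed

section \<open>Substitution off a finite set\<close>

text \<open>A finite set is negligible, and Borel measurability lets integrability pass between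
  \<open>lborel\<close> and its completion. This links integrals over subsets, as in the
  substitution theorem, to integrals over the whole line.\<close>

lemma absolutely_integrable_on_cofinite:
  fixes f :: "real \<Rightarrow> real"
  assumes f: "f \<in> borel_measurable borel" and T: "finite (- T)"
  shows "f absolutely_integrable_on T \<longleftrightarrow> integrable lborel f"
    and "integrable lborel f \<Longrightarrow> integral T f = integral\<^sup>L lborel f"
proof -
  have neg: "negligible {x \<in> T - UNIV. f x \<noteq> 0}" "negligible {x \<in> UNIV - T. f x \<noteq> 0}"
    using negligible_finite[OF finite_subset[OF _ T], of "{x \<in> UNIV - T. f x \<noteq> 0}"] by auto
  have "f absolutely_integrable_on T \<longleftrightarrow> f absolutely_integrable_on UNIV"
    using neg by (rule absolutely_integrable_spike_set_eq)
  also have "\<dots> \<longleftrightarrow> integrable lborel f"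
    using f by (simp add: set_integrable_def integrable_completion)
  finally show "f absolutely_integrable_on T \<longleftrightarrow> integrable lborel f" .
  assume "integrable lborel f"
  then show "integral T f = integral\<^sup>L lborel f"
    using integral_spike_set[OF neg] integral_lborel[of f] by simp
qed

text \<open>The substitution theorem yields equal values and also transfers integrability in both
  directions, so convergence need not be established beforehand.\<close>

lemma lborel_integral_change_of_variables_cofinite:
  fixes f h \<phi> \<phi>' :: "real \<Rightarrow> real"
  assumes f: "f \<in> borel_measurable borel" and h: "h \<in> borel_measurable borel"
    and S: "finite (- S)" and \<phi>S: "finite (- \<phi> ` S)"
    and der: "\<And>x. x \<in> S \<Longrightarrow> (\<phi> has_field_derivative \<phi>' x) (at x)"
    and inj: "inj_on \<phi> S"
    and eq: "\<And>x. x \<in> S \<Longrightarrow> h x = \<bar>\<phi>' x\<bar> * f (\<phi> x)"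
  shows "integral\<^sup>L lborel h = integral\<^sup>L lborel f"
proof -
  have "open S" using finite_imp_closed[OF S] by (simp add: open_closed)
  then have "S \<in> sets lebesgue" by auto
  from has_absolute_integral_change_of_variables_1'
    [OF this has_field_derivative_at_within[OF der] inj, of f]
  have cv: "h absolutely_integrable_on S \<and> integral S h = b \<longleftrightarrow>
      f absolutely_integrable_on \<phi> ` S \<and> integral (\<phi> ` S) f = b" for b
    by (simp add: eq integral_cong[of S h, OF eq] set_integrable_cong[OF refl refl eq])
  note h_int = absolutely_integrable_on_cofinite[OF h S]
  note f_int = absolutely_integrable_on_cofinite[OF f \<phi>S]
  show ?thesis
  proof (cases "integrable lborel h")
    case True
    then show ?thesis using cv[of "integral S h"] h_int f_int by simp
  next
    \<comment> \<open>Both integrals diverge, so both sides take the default value 0.\<close>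
    case False
    then have "\<not> integrable lborel f" using cv h_int f_int by blast
    with False show ?thesis by (simp add: not_integrable_integral_eq)
  qed
qed

section \<open>Inverses, symmetry and congruence of matrices\<close>

lemma mat_inv_inverts:
  assumes "A \<in> carrier_mat n n" "det A \<noteq> 0"
  shows "mat_inv A \<in> carrier_mat n n" "A * mat_inv A = 1\<^sub>m n" "mat_inv A * A = 1\<^sub>m n"
proof -
  have "A \<in> Units (ring_mat TYPE(real) n ())"
    using det_non_zero_imp_unit[OF assms] .
  then obtain B where "mat_inverse A = Some B"
    using mat_inverse(1)[OF assms(1), where b = "()"] by (cases "mat_inverse A") auto
  with mat_inverse(2)[OF assms(1) this]
  show "mat_inv A \<in> carrier_mat n n" "A * mat_inv A = 1\<^sub>m n" "mat_inv A * A = 1\<^sub>m n"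
    unfolding mat_inv_def by auto
qed

lemma left_right_inverse_unique:
  assumes "A \<in> carrier_mat n n" "B \<in> carrier_mat n n" "C \<in> carrier_mat n n"
    and "B * A = 1\<^sub>m n" "A * C = 1\<^sub>m n"
  shows "B = (C :: 'a :: semiring_1 mat)"
proof -
  have "B = B * (A * C)" using assms by simp
  also have "\<dots> = B * A * C" using assms(1-3) by simp
  finally show ?thesis using assms by simp
qed

lemma transpose_mat_inv:
  assumes "A \<in> carrier_mat n n" "det A \<noteq> 0" "transpose_mat A = A"
  shows "transpose_mat (mat_inv A) = mat_inv A"
proof (rule left_right_inverse_unique[OF assms(1)])
  note inv = mat_inv_inverts[OF assms(1,2)]
  show "transpose_mat (mat_inv A) * A = 1\<^sub>m n"
    using arg_cong[OF inv(2), of transpose_mat] transpose_mult[OF assms(1) inv(1)] assms(3)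
    by simp
qed (use mat_inv_inverts[OF assms(1,2)] in auto)

lemma positive_definite_det:
  assumes "positive_definite n M"
  shows "det M \<noteq> 0"
proof
  have M: "M \<in> carrier_mat n n" using assms by (simp add: positive_definite_def)
  assume "det M = 0"
  then obtain v where v: "v \<in> carrier_vec n" "v \<noteq> 0\<^sub>v n" "M *\<^sub>v v = 0\<^sub>v n"
    using det_0_iff_vec_prod_zero[OF M] by blast
  with assms have "v \<bullet> (M *\<^sub>v v) > 0" by (auto simp: positive_definite_def simp del: scalar_prod_right_zero)
  with v show False by simp
qed

text \<open>Formally the left side is \<open>A\<^sup>T (A\<^sup>-\<^sup>T M\<^sup>-\<^sup>1
  A\<^sup>-\<^sup>1) A\<close>. Rather than inverting the factors, the proof checks that it is a
  left inverse of \<open>M\<close>.\<close>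

lemma mat_inv_congruence:
  assumes M: "M \<in> carrier_mat n n" "det M \<noteq> 0" and A: "A \<in> carrier_mat n n" "det A \<noteq> 0"
  shows "transpose_mat A * mat_inv (A * M * transpose_mat A) * A = mat_inv M"
proof (rule left_right_inverse_unique[OF M(1)])
  let ?T = "transpose_mat A"
  let ?N = "A * M * ?T"
  have T: "?T \<in> carrier_mat n n" using A by simp
  have N: "?N \<in> carrier_mat n n" using M A by auto
  have "det ?N \<noteq> 0"
    using A M T by (simp add: det_mult[of _ n] det_transpose[OF A(1)])
  note inv = mat_inv_inverts[OF N this]
  have "mat_inv ?N * A * M * ?T = 1\<^sub>m n"
    using inv(3) inv(1) A(1) M(1) T by (simp add: assoc_mult_mat[of _ n n _ n _ n])
  \<comment> \<open>For square matrices a one-sided inverse is two-sided, so \<open>?T\<close> may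
    move from the right end of the product to the left.\<close>
  then have "?T * (mat_inv ?N * A * M) = 1\<^sub>m n"
    by (rule mat_mult_left_right_inverse[rotated 2]) (use inv(1) A(1) M(1) in auto)
  then show "?T * mat_inv ?N * A * M = 1\<^sub>m n"
    using inv(1) A(1) M(1) T by (simp add: assoc_mult_mat[of _ n n _ n _ n])
  show "?T * mat_inv ?N * A \<in> carrier_mat n n"
    using inv(1) A(1) T by auto
qed (use mat_inv_inverts[OF M] in auto)

lemma scalar_prod_congruence:
  assumes "S \<in> carrier_mat n n" "A \<in> carrier_mat n n" "v \<in> carrier_vec n" "w \<in> carrier_vec n"
  shows "v \<bullet> ((transpose_mat A * S * A) *\<^sub>v w) = (A *\<^sub>v v) \<bullet> (S *\<^sub>v (A *\<^sub>v (w :: real vec)))"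
proof -
  have "(transpose_mat A * S * A) *\<^sub>v w = transpose_mat A *\<^sub>v (S *\<^sub>v (A *\<^sub>v w))"
    using assms by (simp add: assoc_mult_mat_vec[of _ n n _ n])
  then show ?thesis
    using transpose_vec_mult_scalar[of "transpose_mat A" n n "S *\<^sub>v (A *\<^sub>v w)" v] assms by simp
qed

text \<open>The pair \<open>(F, G)\<close> arises from \<open>(f, g)\<close> by a triangular
  substitution of determinant \<open>u * (u * p)\<close>. The Gram determinant is multiplied by the
  square of this, so \<open>v\<close> drops out; the denominator is multiplied by
  \<open>u\<^sup>2\<close>, and only \<bar>p\<bar> survives.\<close>

lemma gram_quotient_scale:
  fixes f g :: "real vec" and S :: "real mat"
  assumes S: "S \<in> carrier_mat n n" "transpose_mat S = S"
    and f: "f \<in> carrier_vec n" and g: "g \<in> carrier_vec n" and u: "u \<noteq> 0"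
    and F: "F = u \<cdot>\<^sub>v f" and G: "G = v \<cdot>\<^sub>v f + (u * p) \<cdot>\<^sub>v g"
  shows "sqrt ((F \<bullet> (S *\<^sub>v F)) * (G \<bullet> (S *\<^sub>v G)) - (F \<bullet> (S *\<^sub>v G))\<^sup>2) / (F \<bullet> (S *\<^sub>v F)) =
    \<bar>p\<bar> * (sqrt ((f \<bullet> (S *\<^sub>v f)) * (g \<bullet> (S *\<^sub>v g)) - (f \<bullet> (S *\<^sub>v g))\<^sup>2) / (f \<bullet> (S *\<^sub>v f)))"
proof -
  have Sf: "S *\<^sub>v f \<in> carrier_vec n" and Sg: "S *\<^sub>v g \<in> carrier_vec n"
    using S f g by auto
  have sym: "g \<bullet> (S *\<^sub>v f) = f \<bullet> (S *\<^sub>v g)"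
    using transpose_vec_mult_scalar[OF S(1) f g] comm_scalar_prod[OF f Sg] S(2) by simp
  have SF: "S *\<^sub>v F = u \<cdot>\<^sub>v (S *\<^sub>v f)"
    using S f by (simp add: F mult_mat_vec[of _ n n])
  have SG: "S *\<^sub>v G = v \<cdot>\<^sub>v (S *\<^sub>v f) + (u * p) \<cdot>\<^sub>v (S *\<^sub>v g)"
    using S f g by (simp add: G mult_mat_vec[of _ n n] mult_add_distrib_mat_vec[of _ n n])
  have FF: "F \<bullet> (S *\<^sub>v F) = u\<^sup>2 * (f \<bullet> (S *\<^sub>v f))"
    using f Sf unfolding SF by (simp add: F power2_eq_square)
  have FG: "F \<bullet> (S *\<^sub>v G) = u * (v * (f \<bullet> (S *\<^sub>v f)) + u * p * (f \<bullet> (S *\<^sub>v g)))"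
    using f Sf Sg unfolding SG by (simp add: F scalar_prod_add_distrib[of _ n] algebra_simps)
  have GG: "G \<bullet> (S *\<^sub>v G) = v\<^sup>2 * (f \<bullet> (S *\<^sub>v f)) + 2 * u * p * v * (f \<bullet> (S *\<^sub>v g))
      + (u * p)\<^sup>2 * (g \<bullet> (S *\<^sub>v g))"
    using f g Sf Sg unfolding SG
    by (simp add: G scalar_prod_add_distrib[of _ n] add_scalar_prod_distrib[of _ n] sym
        power2_eq_square algebra_simps)
  have gram: "(F \<bullet> (S *\<^sub>v F)) * (G \<bullet> (S *\<^sub>v G)) - (F \<bullet> (S *\<^sub>v G))\<^sup>2 =
      (u\<^sup>2 * p)\<^sup>2 * ((f \<bullet> (S *\<^sub>v f)) * (g \<bullet> (S *\<^sub>v g)) - (f \<bullet> (S *\<^sub>v g))\<^sup>2)"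
    unfolding FF FG GG by (simp add: power2_eq_square algebra_simps)
  have "sqrt ((u\<^sup>2 * p)\<^sup>2) = u\<^sup>2 * \<bar>p\<bar>"
    by (simp add: abs_mult)
  then show ?thesis
    unfolding gram real_sqrt_mult using u by (simp add: FF)
qed

section \<open>Action of the Moebius matrices on the curve and its tangent\<close>

lemma moebius_mat_mult_f_P:
  fixes x :: real
  assumes k: "a * d - b * c \<noteq> 0" and x: "c * x + d \<noteq> 0"
  shows "moebius_mat n a b c d *\<^sub>v f_P n x =
    (c * x + d) ^ (n - 1) \<cdot>\<^sub>v f_P n ((a * x + b) / (c * x + d))"
proof (rule eq_vecI)
  fix i assume "i < dim_vec ((c * x + d) ^ (n - 1) \<cdot>\<^sub>v f_P n ((a * x + b) / (c * x + d)))"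
  then have i: "i < n" by simp
  have "(c * x + d) ^ (n - 1) = (c * x + d) ^ i * (c * x + d) ^ (n - 1 - i)"
    using i by (simp flip: power_add)
  then show "(moebius_mat n a b c d *\<^sub>v f_P n x) $ i =
      ((c * x + d) ^ (n - 1) \<cdot>\<^sub>v f_P n ((a * x + b) / (c * x + d))) $ i"
    using x i unfolding moebius_mat_f_P[OF k] by (simp add: f_P_def power_divide)
qed (simp add: moebius_mat_f_P[OF k])

lemma moebius_map_has_field_derivative:
  fixes x :: real
  assumes "c * x + d \<noteq> 0"
  shows "((\<lambda>x. (a * x + b) / (c * x + d)) has_field_derivative
    (a * d - b * c) / (c * x + d)\<^sup>2) (at x)"
  using assms
  by (auto intro!: derivative_eq_intros simp: power2_eq_square divide_simps) (simp add: algebra_simps)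

text \<open>Differentiate \<open>A f(x) = u(x) f(\<phi> x)\<close>: the left side gives
  \<open>A g(x)\<close>, the right side
  \<open>u'(x) f(\<phi> x) + u(x) \<phi>'(x) g(\<phi> x)\<close>. The coefficient \<open>v\<close>
  is left existential because it cancels in the Gram determinant.\<close>

lemma moebius_mat_mult_g_P:
  fixes x :: real
  assumes k: "a * d - b * c \<noteq> 0" and x: "c * x + d \<noteq> 0"
  obtains v where "moebius_mat n a b c d *\<^sub>v g_P n x =
    v \<cdot>\<^sub>v f_P n ((a * x + b) / (c * x + d)) +
    ((c * x + d) ^ (n - 1) * ((a * d - b * c) / (c * x + d)\<^sup>2)) \<cdot>\<^sub>v g_P n ((a * x + b) / (c * x + d))"
proof
  let ?A = "moebius_mat n a b c d"
  let ?u = "\<lambda>x. (c * x + d) ^ (n - 1)" and ?\<phi> = "\<lambda>x. (a * x + b) / (c * x + d)"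
  let ?p = "(a * d - b * c) / (c * x + d)\<^sup>2"
  \<comment> \<open>This is the derivative of \<open>?u\<close> at \<open>x\<close>; if
    \<open>n - 1 = 0\<close>, the factor \<open>real (n - 1)\<close> makes the truncated exponent
    harmless.\<close>
  let ?v = "real (n - 1) * c * (c * x + d) ^ (n - 1 - 1)"
  have A: "?A \<in> carrier_mat n n" by (rule moebius_mat_carrier[OF k])
  show "?A *\<^sub>v g_P n x = ?v \<cdot>\<^sub>v f_P n (?\<phi> x) + (?u x * ?p) \<cdot>\<^sub>v g_P n (?\<phi> x)"
  proof (rule eq_vecI)
    fix i assume "i < dim_vec (?v \<cdot>\<^sub>v f_P n (?\<phi> x) + (?u x * ?p) \<cdot>\<^sub>v g_P n (?\<phi> x))"
    then have i: "i < n" by (simp add: g_P_def)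
    have "((\<lambda>y. \<Sum>j<n. ?A $$ (i, j) * y ^ j) has_field_derivative
        (\<Sum>j<n. ?A $$ (i, j) * (real j * x ^ (j - 1)))) (at x)"
      by (auto intro!: derivative_eq_intros sum.cong)
    also have "(\<Sum>j<n. ?A $$ (i, j) * (real j * x ^ (j - 1))) = (?A *\<^sub>v g_P n x) $ i"
      using A i by (auto simp: scalar_prod_def g_P_eq atLeast0LessThan intro!: sum.cong)
    finally have D1: "((\<lambda>y. (?A *\<^sub>v f_P n y) $ i) has_field_derivative (?A *\<^sub>v g_P n x) $ i) (at x)"
      by (simp only: mult_f_P[OF A i])
    have "((\<lambda>y. ?u y * ?\<phi> y ^ i) has_field_derivative
        ?v * ?\<phi> x ^ i + (real i * ?\<phi> x ^ (i - 1) * ?p) * ?u x) (at x)"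
    proof (rule DERIV_mult)
      show "(?u has_field_derivative ?v) (at x)"
        by (auto intro!: derivative_eq_intros)
      show "((\<lambda>y. ?\<phi> y ^ i) has_field_derivative real i * ?\<phi> x ^ (i - 1) * ?p) (at x)"
        using DERIV_power[OF moebius_map_has_field_derivative[OF x], of a b i]
        by (simp add: mult_ac)
    qed
    \<comment> \<open>The factored form of the polynomial holds only away from the pole, but that
      set is open and contains \<open>x\<close>, so the derivative at \<open>x\<close> is the
      same.\<close>
    then have "((\<lambda>y. (?A *\<^sub>v f_P n y) $ i) has_field_derivative
        ?v * ?\<phi> x ^ i + (real i * ?\<phi> x ^ (i - 1) * ?p) * ?u x) (at x)"
    proof (rule has_field_derivative_transform_within_open)
      show "open {y. c * y + d \<noteq> 0}" by (intro open_Collect_neq continuous_intros)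
      fix y assume "y \<in> {y. c * y + d \<noteq> 0}"
      then show "?u y * ?\<phi> y ^ i = (?A *\<^sub>v f_P n y) $ i"
        using i moebius_mat_mult_f_P[OF k, of y n] by (simp add: f_P_def)
    qed (use x in simp)
    from DERIV_unique[OF D1 this]
    show "(?A *\<^sub>v g_P n x) $ i = (?v \<cdot>\<^sub>v f_P n (?\<phi> x) + (?u x * ?p) \<cdot>\<^sub>v g_P n (?\<phi> x)) $ i"
      using i by (simp add: f_P_def g_P_eq)
  qed (use A in \<open>simp add: g_P_def\<close>)
qed

lemma tube_density_congruence:
  assumes S: "S \<in> carrier_mat n n" "transpose_mat S = S"
    and k: "a * d - b * c \<noteq> 0" and x: "c * x + d \<noteq> 0" and A: "A = moebius_mat n a b c d"
  shows "tube_density n (transpose_mat A * S * A) x =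
    \<bar>(a * d - b * c) / (c * x + d)\<^sup>2\<bar> * tube_density n S ((a * x + b) / (c * x + d))"
proof -
  have carrier: "A \<in> carrier_mat n n" using moebius_mat_carrier[OF k] by (simp add: A)
  obtain v where "A *\<^sub>v g_P n x =
    v \<cdot>\<^sub>v f_P n ((a * x + b) / (c * x + d)) +
    ((c * x + d) ^ (n - 1) * ((a * d - b * c) / (c * x + d)\<^sup>2)) \<cdot>\<^sub>v g_P n ((a * x + b) / (c * x + d))"
    using moebius_mat_mult_g_P[OF k x, of n] by (metis A)
  from gram_quotient_scale[OF S f_P_carrier g_P_carrier _ moebius_mat_mult_f_P[OF k x, of n, folded A] this]
  show ?thesis
    using x by (simp add: tube_density_def scalar_prod_congruence[OF S(1) carrier] del: assoc_mult_mat)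
qed

text \<open>The adjugate coefficients \<open>d, -b, -c, a\<close> give the inverse Moebius map.
  Composing the two actions on the curve gives a scalar matrix with nonzero factor
  \<open>(a * d - b * c) ^ (n - 1)\<close>.\<close>

lemma moebius_mat_det:
  assumes k: "a * d - b * c \<noteq> (0::real)"
  shows "det (moebius_mat n a b c d) \<noteq> 0"
proof -
  let ?k = "a * d - b * c"
  let ?A = "moebius_mat n a b c d" and ?B = "moebius_mat n d (- b) (- c) a"
  have k': "d * a - (- b) * (- c) \<noteq> 0" using k by (simp add: mult.commute)
  have A: "?A \<in> carrier_mat n n" and B: "?B \<in> carrier_mat n n"
    using moebius_mat_carrier k k' by blast+
  have "?B * ?A = ?k ^ (n - 1) \<cdot>\<^sub>m 1\<^sub>m n"
  proof (rule moebius_mat_unique)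
    fix x assume x: "c * x + d \<noteq> 0"
    let ?y = "(a * x + b) / (c * x + d)"
    \<comment> \<open>Numerator and denominator of the inverse map at \<open>?y\<close>; their
      quotient is \<open>x\<close>.\<close>
    have y: "- c * ?y + a = ?k / (c * x + d)" "d * ?y + - b = ?k * x / (c * x + d)"
      using x by (simp_all add: field_simps)
    have "(?B * ?A) *\<^sub>v f_P n x = ?B *\<^sub>v ((c * x + d) ^ (n - 1) \<cdot>\<^sub>v f_P n ?y)"
      using A B by (simp add: moebius_mat_mult_f_P[OF k x])
    also have "\<dots> = (c * x + d) ^ (n - 1) \<cdot>\<^sub>v (?B *\<^sub>v f_P n ?y)"
      by (rule mult_mat_vec[OF B]) simp
    also have "?B *\<^sub>v f_P n ?y = (- c * ?y + a) ^ (n - 1) \<cdot>\<^sub>v f_P n ((d * ?y + - b) / (- c * ?y + a))"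
      by (rule moebius_mat_mult_f_P[OF k']) (use y(1) k x in simp)
    also have "\<dots> = (?k / (c * x + d)) ^ (n - 1) \<cdot>\<^sub>v f_P n x"
      unfolding y using k x by simp
    also have "(c * x + d) ^ (n - 1) \<cdot>\<^sub>v ((?k / (c * x + d)) ^ (n - 1) \<cdot>\<^sub>v f_P n x) = ?k ^ (n - 1) \<cdot>\<^sub>v f_P n x"
      using x by (simp add: smult_smult_assoc power_divide)
    finally show "(?B * ?A) *\<^sub>v f_P n x = (?k ^ (n - 1) \<cdot>\<^sub>m 1\<^sub>m n) *\<^sub>v f_P n x"
      by (intro eq_vecI) simp_all
  qed (use A B k in auto)
  from arg_cong[OF this, of det] have "det ?B * det ?A = (?k ^ (n - 1)) ^ n"
    using A B by (simp add: det_mult[of _ n] det_smult)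
  with k show ?thesis by auto
qed

section \<open>Invariance of the volume\<close>

lemma Vol\<^sub>1_moebius_congruence:
  assumes S: "S \<in> carrier_mat n n" "transpose_mat S = S"
    and k: "a * d - b * c \<noteq> 0" and A: "A = moebius_mat n a b c d"
  shows "Vol\<^sub>1 n (transpose_mat A * S * A) = Vol\<^sub>1 n S"
proof -
  let ?X = "{x. c * x + d \<noteq> 0}" and ?\<phi> = "\<lambda>x. (a * x + b) / (c * x + d)"
  have carrier: "transpose_mat A * S * A \<in> carrier_mat n n"
    using S(1) moebius_mat_carrier[OF k, of n] by (auto simp: A)
  \<comment> \<open>If \<open>c = 0\<close>, then \<open>d\<close> is nonzero and there is no pole,
    so the inclusion is trivial.\<close>
  have "- ?X \<subseteq> {- d / c}"
    using k by (cases "c = 0") (auto simp: field_simps eq_neg_iff_add_eq_0)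
  then have X: "finite (- ?X)" by (rule finite_subset) simp
  \<comment> \<open>The only value that can be missed is the image of infinity; if
    \<open>c = 0\<close>, none is missed, since \<open>a\<close> is then nonzero.\<close>
  have "- ?\<phi> ` ?X \<subseteq> {a / c}"
  proof
    fix y assume y: "y \<in> - ?\<phi> ` ?X"
    have "c * y = a"
    proof (rule ccontr)
      assume "c * y \<noteq> a"
      then have ne: "a - c * y \<noteq> 0" by simp
      \<comment> \<open>The preimage of \<open>y\<close> under \<phi>, obtained from the inverse
        Moebius map.\<close>
      let ?x = "(d * y - b) / (a - c * y)"
      have "c * ?x + d = (a * d - b * c) / (a - c * y)" "a * ?x + b = y * (a * d - b * c) / (a - c * y)"
        using ne by (simp_all add: field_simps)
      then have "?x \<in> ?X" "?\<phi> ?x = y" using k ne by simp_all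
      with y show False using image_eqI[of y ?\<phi> ?x ?X] by auto
    qed
    with k show "y \<in> {a / c}" by (cases "c = 0") (auto simp: field_simps)
  qed
  then have \<phi>X: "finite (- ?\<phi> ` ?X)" by (rule finite_subset) simp
  have inj: "inj_on ?\<phi> ?X"
  proof (rule inj_onI)
    fix x y assume "x \<in> ?X" "y \<in> ?X" "?\<phi> x = ?\<phi> y"
    then have "(a * x + b) * (c * y + d) = (a * y + b) * (c * x + d)"
      by (simp add: frac_eq_eq)
    then have "(a * d - b * c) * (x - y) = 0" by (simp add: algebra_simps)
    with k show "x = y" by simp
  qed
  have "integral\<^sup>L lborel (tube_density n (transpose_mat A * S * A)) =
      integral\<^sup>L lborel (tube_density n S)"
    by (rule lborel_integral_change_of_variables_cofinite[OF tube_density_measurable[OF S(1)]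
          tube_density_measurable[OF carrier] X \<phi>X _ inj,
          where \<phi>' = "\<lambda>x. (a * d - b * c) / (c * x + d)\<^sup>2"])
      (use k in \<open>simp_all add: moebius_map_has_field_derivative tube_density_congruence[OF S k _ A]\<close>)
  then show ?thesis by (simp add: Vol\<^sub>1_eq_tube_density)
qed

theorem theorem3p16:
  fixes n :: nat and M A :: "real mat"
  assumes "n \<ge> 2"
    and "M \<in> moment_cone n"
    and "A \<in> moebius_mats n"
  shows "Vol\<^sub>1 n (mat_inv M) = Vol\<^sub>1 n (mat_inv (A * M * transpose_mat A))"
proof -
  have "positive_definite n M" using assms(2) by (simp add: moment_cone_def)
  then have M: "M \<in> carrier_mat n n" "det M \<noteq> 0" and symM: "transpose_mat M = M"
    using positive_definite_det by (auto simp: positive_definite_def)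
  obtain a b c d where k: "a * d - b * c \<noteq> 0" and A_eq: "A = moebius_mat n a b c d"
    using assms(3) by (auto simp: moebius_mats_def)
  have A: "A \<in> carrier_mat n n" "det A \<noteq> 0"
    using moebius_mat_carrier[OF k] moebius_mat_det[OF k] by (simp_all add: A_eq)
  let ?N = "A * M * transpose_mat A"
  have N: "?N \<in> carrier_mat n n" using M A by auto
  have detN: "det ?N \<noteq> 0"
    using A M by (simp add: det_mult[of _ n] det_transpose[OF A(1)])
  \<comment> \<open>Symmetry passes from \<open>M\<close> to \<open>?N\<close> and then to its
    inverse, where it identifies the two mixed products \<open>f \<bullet> S g\<close> and
    \<open>g \<bullet> S f\<close> in the Gram determinant.\<close>
  have "transpose_mat ?N = ?N"
    using A(1) M(1) symM transpose_mult[of "A * M" n n "transpose_mat A" n] transpose_mult[of A n n M n]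
    by simp
  note symN = transpose_mat_inv[OF N detN this]
  show ?thesis
    using Vol\<^sub>1_moebius_congruence[OF mat_inv_inverts(1)[OF N detN] symN k A_eq]
      mat_inv_congruence[OF M A] by simp
qed

end
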